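(* Every positive integer $n\equiv 4\pmod 5$ that is a sum of three squares of integers is a sum of three nonunit squares, except for $n=14$ and $n=19$.
   Context: A positive integer $n$ is called a sum of three nonunit squares if there exist integers $x,y,z$ with $n=x^2+y^2+z^2$ and $(x^2-1)(y^2-1)(z^2-1)\neq 0$ (zero is allowed as a value of $x,y,z$). *)

theory Defs
  imports "HOL-Number_Theory.Cong"
begin

definition sum_of_three_squares :: "int \<Rightarrow> bool" where
  "sum_of_three_squares n \<longleftrightarrow> (\<exists>x y z :: int. n = x^2 + y^2 + z^2)"

definition sum_of_three_nonunit_squares :: "int \<Rightarrow> bool" where
  "sum_of_three_nonunit_squares n \<longleftrightarrow>
     (\<exists>x y z :: int. n = x^2 + y^2 + z^2 \<and> (x^2 - 1) * (y^2 - 1) * (z^2 - 1) \<noteq> 0)"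

end

theory Submission
  imports Defs
begin

text \<open>
  In a sum of three nonunit squares every odd square is at least 9, and the number of odd squares
  is the residue of the sum modulo 4; this excludes 14 and 19.

  Conversely, squares are 0, 1 or 4 modulo 5, so if a representation of \<open>n\<close> contains a unit, the
  other two squares are congruent to 4. The rotation with entries 3/5 and 4/5 maps the integer
  point \<open>(1, 2 + 5 k)\<close> to the integer point \<open>(2 + 3 k, 1 + 4 k)\<close>, which removes the unit unless \<open>k\<close>
  is 0 or -1, that is, unless the square \<open>(2 + 5 k)\<^sup>2\<close> is 4 or 9. If both squares are 4 or 9,
  then \<open>n\<close> is 9, 14 or 19, and \<open>9 = 3\<^sup>2 + 0\<^sup>2 + 0\<^sup>2\<close>.
\<close>

lemma sum_of_three_nonunit_squares_iff:
  "sum_of_three_nonunit_squares n \<longleftrightarrow>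
     (\<exists>x y z. n = x\<^sup>2 + y\<^sup>2 + z\<^sup>2 \<and> x\<^sup>2 \<noteq> 1 \<and> y\<^sup>2 \<noteq> 1 \<and> z\<^sup>2 \<noteq> 1)"
  by (simp add: sum_of_three_nonunit_squares_def)

lemma square_mod_4:
  fixes x :: int
  shows "x\<^sup>2 mod 4 = x mod 2"
proof -
  have "x mod 4 \<in> {0, 1, 2, 3}" by auto
  moreover have "x\<^sup>2 mod 4 = (x mod 4)\<^sup>2 mod 4" by (simp add: power_mod)
  moreover have "x mod 2 = x mod 4 mod 2" by (simp add: mod_mod_cancel)
  ultimately show ?thesis by auto
qed

lemma nonunit_square_ge_9_times_mod_4:
  fixes x :: int
  assumes "x\<^sup>2 \<noteq> 1"
  shows "9 * (x\<^sup>2 mod 4) \<le> x\<^sup>2"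
proof (cases "even x")
  case True
  then show ?thesis by (simp add: square_mod_4 even_iff_mod_2_eq_zero)
next
  case False
  moreover from assms have "\<bar>x\<bar> \<noteq> 1" by (simp add: abs_square_eq_1)
  ultimately have "\<bar>3\<bar> \<le> \<bar>x\<bar>" by presburger
  then have "3\<^sup>2 \<le> x\<^sup>2" by (simp only: abs_le_square_iff)
  with False show ?thesis by (simp add: square_mod_4 odd_iff_mod_2_eq_one)
qed

lemma sum_of_three_nonunit_squares_ge_9_times_mod_4:
  assumes "sum_of_three_nonunit_squares n"
  shows "9 * (n mod 4) \<le> n"
proof -
  obtain x y z where n: "n = x\<^sup>2 + y\<^sup>2 + z\<^sup>2" and nonunit: "x\<^sup>2 \<noteq> 1" "y\<^sup>2 \<noteq> 1" "z\<^sup>2 \<noteq> 1"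
    using assms unfolding sum_of_three_nonunit_squares_iff by blast
  have "n mod 4 = (x\<^sup>2 mod 4 + y\<^sup>2 mod 4 + z\<^sup>2 mod 4) mod 4"
    unfolding n by (intro mod_add_cong) simp_all
  also have "\<dots> \<le> x\<^sup>2 mod 4 + y\<^sup>2 mod 4 + z\<^sup>2 mod 4"
    by (intro zmod_le_nonneg_dividend) simp
  finally have "9 * (n mod 4) \<le> 9 * (x\<^sup>2 mod 4 + y\<^sup>2 mod 4 + z\<^sup>2 mod 4)"
    by (rule mult_left_mono) simp
  also have "\<dots> = 9 * (x\<^sup>2 mod 4) + 9 * (y\<^sup>2 mod 4) + 9 * (z\<^sup>2 mod 4)"
    by (simp only: distrib_left)
  also have "\<dots> \<le> n"
    unfolding n using nonunit by (intro add_mono nonunit_square_ge_9_times_mod_4)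
  finally show ?thesis .
qed

lemma prime_elem_dvd_diff_squaresE:
  fixes p a y :: "'a :: comm_ring_1"
  assumes "prime_elem p" and "p dvd y\<^sup>2 - a\<^sup>2"
  obtains k where "y\<^sup>2 = (a + p * k)\<^sup>2"
proof -
  have "p dvd (y - a) * (y + a)"
    using assms(2) by (simp add: power2_eq_square algebra_simps)
  with assms(1) consider (diff) "p dvd y - a" | (sum) "p dvd y + a"
    by (blast dest: prime_elem_dvd_multD)
  then show thesis
  proof cases
    case diff
    then obtain k where "y - a = p * k" ..
    then have "y = a + p * k" by (simp add: algebra_simps)
    then show thesis using that by blast
  next
    case sum
    then obtain k where "y + a = p * k" ..
    then have "y = - (a + p * (- k))" by (simp add: algebra_simps)
    then show thesis using that by (metis power2_minus)
  qed
qed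

lemma square_mod_5_cases:
  fixes y :: int
  shows "y\<^sup>2 mod 5 \<in> {0, 1, 4}"
proof -
  have "y mod 5 \<in> {0, 1, 2, 3, 4}" by auto
  moreover have "y\<^sup>2 mod 5 = (y mod 5)\<^sup>2 mod 5" by (simp add: power_mod)
  ultimately show ?thesis by auto
qed

lemma one_plus_two_squares_cong_4_mod_5:
  fixes y z :: int
  assumes "[1 + y\<^sup>2 + z\<^sup>2 = 4] (mod 5)"
  shows "[y\<^sup>2 = 4] (mod 5)" and "[z\<^sup>2 = 4] (mod 5)"
proof -
  have "(1 + y\<^sup>2 mod 5 + z\<^sup>2 mod 5) mod 5 = (1 + y\<^sup>2 + z\<^sup>2) mod 5"
    by (intro mod_add_cong) simp_all
  also have "\<dots> = 4"
    using assms by (simp add: cong_def)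
  finally have "(1 + y\<^sup>2 mod 5 + z\<^sup>2 mod 5) mod 5 = 4" .
  with square_mod_5_cases[of y] square_mod_5_cases[of z]
  show "[y\<^sup>2 = 4] (mod 5)" and "[z\<^sup>2 = 4] (mod 5)"
    by (auto simp: cong_def)
qed

lemma one_plus_square_rotated:
  fixes k :: "'a :: comm_ring_1"
  shows "1 + (2 + 5 * k)\<^sup>2 = (2 + 3 * k)\<^sup>2 + (1 + 4 * k)\<^sup>2"
  by (simp add: power2_eq_square algebra_simps)

lemma one_plus_square_eq_nonunit_squaresE:
  fixes y :: int
  assumes "[y\<^sup>2 = 4] (mod 5)" and "y\<^sup>2 \<notin> {4, 9}"
  obtains u v :: int where "1 + y\<^sup>2 = u\<^sup>2 + v\<^sup>2" and "u\<^sup>2 \<noteq> 1" and "v\<^sup>2 \<noteq> 1"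
proof -
  have "prime_elem (5 :: int)" by simp
  moreover have "5 dvd y\<^sup>2 - 2\<^sup>2" using assms(1) by (simp add: cong_iff_dvd_diff)
  ultimately obtain k where k: "y\<^sup>2 = (2 + 5 * k)\<^sup>2"
    by (rule prime_elem_dvd_diff_squaresE)
  with assms(2) have "k \<noteq> 0" "k \<noteq> -1" by auto
  then have "(2 + 3 * k)\<^sup>2 \<noteq> 1" and "(1 + 4 * k)\<^sup>2 \<noteq> 1"
    unfolding power2_eq_1_iff by presburger+
  with that show thesis by (simp add: k one_plus_square_rotated)
qed

lemma one_plus_two_squares_nonunitI:
  fixes y z :: int
  assumes "[y\<^sup>2 = 4] (mod 5)" and "[z\<^sup>2 = 4] (mod 5)" and "y\<^sup>2 \<notin> {4, 9}"
  shows "sum_of_three_nonunit_squares (1 + y\<^sup>2 + z\<^sup>2)"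
proof -
  obtain u v where "1 + y\<^sup>2 = u\<^sup>2 + v\<^sup>2" "u\<^sup>2 \<noteq> 1" "v\<^sup>2 \<noteq> 1"
    using assms(1,3) by (rule one_plus_square_eq_nonunit_squaresE)
  moreover have "z\<^sup>2 \<noteq> 1" using assms(2) by (auto simp: cong_def)
  ultimately show ?thesis unfolding sum_of_three_nonunit_squares_iff by metis
qed

lemma sum_of_three_nonunit_squares_9: "sum_of_three_nonunit_squares 9"
  unfolding sum_of_three_nonunit_squares_iff by (intro exI[of _ 3] exI[of _ 0]) simp

lemma one_plus_two_squares_nonunit_or_14_or_19:
  fixes y z :: int
  assumes n: "n = 1 + y\<^sup>2 + z\<^sup>2" and "[n = 4] (mod 5)"
  shows "sum_of_three_nonunit_squares n \<or> n = 14 \<or> n = 19"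
proof -
  from assms have y: "[y\<^sup>2 = 4] (mod 5)" and z: "[z\<^sup>2 = 4] (mod 5)"
    using one_plus_two_squares_cong_4_mod_5 by blast+
  consider (y_movable) "y\<^sup>2 \<notin> {4, 9}" | (z_movable) "z\<^sup>2 \<notin> {4, 9}"
    | (exceptional) "y\<^sup>2 \<in> {4, 9}" "z\<^sup>2 \<in> {4, 9}" by blast
  then show ?thesis
  proof cases
    case y_movable
    with one_plus_two_squares_nonunitI[OF y z] n show ?thesis by simp
  next
    case z_movable
    with one_plus_two_squares_nonunitI[OF z y] n show ?thesis by (simp add: ac_simps)
  next
    case exceptional
    with n have "n \<in> {9, 14, 19}" by auto
    with sum_of_three_nonunit_squares_9 show ?thesis by auto
  qed
qed

lemma sum_of_three_squares_cases:
  assumes "sum_of_three_squares n"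
  obtains (nonunit) "sum_of_three_nonunit_squares n" | (unit) y z where "n = 1 + y\<^sup>2 + z\<^sup>2"
proof -
  obtain x y z where n: "n = x\<^sup>2 + y\<^sup>2 + z\<^sup>2"
    using assms unfolding sum_of_three_squares_def by blast
  consider (x_unit) "x\<^sup>2 = 1" | (y_unit) "y\<^sup>2 = 1" | (z_unit) "z\<^sup>2 = 1"
    | (no_unit) "x\<^sup>2 \<noteq> 1" "y\<^sup>2 \<noteq> 1" "z\<^sup>2 \<noteq> 1" by blast
  then show thesis
  proof cases
    case x_unit
    with n show thesis by (intro unit[of y z]) simp
  next
    case y_unit
    with n show thesis by (intro unit[of x z]) simp
  next
    case z_unit
    with n show thesis by (intro unit[of x y]) simp
  next
    case no_unit
    with n nonunit show thesis unfolding sum_of_three_nonunit_squares_iff by blast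
  qed
qed

theorem theorem2p4:
  fixes n :: int
  assumes "n > 0"
    and "[n = 4] (mod 5)"
    and "sum_of_three_squares n"
  shows "sum_of_three_nonunit_squares n \<longleftrightarrow> n \<noteq> 14 \<and> n \<noteq> 19"
proof
  assume "sum_of_three_nonunit_squares n"
  then have "9 * (n mod 4) \<le> n" by (rule sum_of_three_nonunit_squares_ge_9_times_mod_4)
  then show "n \<noteq> 14 \<and> n \<noteq> 19" by auto
next
  assume not_exceptional: "n \<noteq> 14 \<and> n \<noteq> 19"
  from assms(3) show "sum_of_three_nonunit_squares n"
  proof (cases rule: sum_of_three_squares_cases)
    case nonunit
    then show ?thesis .
  next
    case (unit y z)
    then show ?thesis
      using one_plus_two_squares_nonunit_or_14_or_19 assms(2) not_exceptional by blast
  qed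
qed

end
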